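(* Let $k \ge 1$ and $3 \le m \le n \le k+1$. Then $d_k(P_m \boxtimes P_n) = m+1$.
   Context: $P_n$ is the path on $n$ vertices. $P_m \boxtimes P_n$ is the strong product (strong grid): vertices $(i,j)$, $0\le i\le m-1$, $0\le j\le n-1$, with distinct $(i,j)$, $(i',j')$ adjacent iff $|i-i'|\le 1$ and $|j-j'|\le 1$. The $k$-move deduction game ($k$ a positive integer) on a finite graph $G$: a layout places a finite number of searchers on vertices of $G$ (several searchers may share a vertex). Every searcher is initially mobile. A vertex is protected once it has been occupied by some searcher (so initially occupied vertices are protected); other vertices are unprotected. The game proceeds in stages. At each stage, for every vertex $v$ that has at least one unprotected neighbour: if the number of mobile searchers on $v$ is at least the number of unprotected neighbours of $v$, then the mobile searchers on $v$ move to the unprotected neighbours of $v$ so that each unprotected neighbour receives at least one searcher; excess mobile searchers on $v$ may also move to any of these unprotected neighbours. All moves in a stage happen simultaneously, newly occupied vertices become protected, and a searcher that has moved $k$ times becomes immobile. The process repeats until all vertices are protected or no searcher can move. A layout is successful if all vertices of $G$ end up protected. The $k$-move deduction number $d_k(G)$ is the minimum number of searchers in a successful layout on $G$. *)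

theory Defs
  imports "Graph_Theory.Pair_Digraph"
begin

section \<open>Paths and strong products\<close>

text \<open>
  A finite simple graph is a \<open>pair_graph\<close>: a finite loop-free digraph without parallel arcs whose
  arc relation is symmetric.  An undirected edge appears as the two opposite arcs.
\<close>

definition path_graph :: "nat \<Rightarrow> nat pair_pre_digraph" where
  "path_graph n = \<lparr> pverts = {..<n}, parcs = {(i, j). i < n \<and> j < n \<and> (j = Suc i \<or> i = Suc j)} \<rparr>"

definition strong_product ::
    "'a pair_pre_digraph \<Rightarrow> 'b pair_pre_digraph \<Rightarrow> ('a \<times> 'b) pair_pre_digraph" (infixl "\<boxtimes>" 70) where
  "G \<boxtimes> H = \<lparr> pverts = pverts G \<times> pverts H,
     parcs = {(p, q). p \<in> pverts G \<times> pverts H \<and> q \<in> pverts G \<times> pverts H \<and> p \<noteq> q \<and>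
       (fst p = fst q \<or> (fst p, fst q) \<in> parcs G) \<and>
       (snd p = snd q \<or> (snd p, snd q) \<in> parcs H)} \<rparr>"

lemma pair_graph_path_graph: "pair_graph (path_graph n)"
proof -
  have "parcs (path_graph n) \<subseteq> {..<n} \<times> {..<n}"
    by (auto simp: path_graph_def)
  then have "finite (parcs (path_graph n))"
    by (rule finite_subset) simp
  moreover have "sym (parcs (path_graph n))"
    by (auto simp: path_graph_def sym_def)
  ultimately show ?thesis
    by unfold_locales (auto simp: path_graph_def symmetric_def)
qed

lemma pair_graph_strong_product:
  assumes "pair_graph G" "pair_graph H"
  shows "pair_graph (G \<boxtimes> H)"
proof -
  interpret G: pair_graph G by fact
  interpret H: pair_graph H by fact
  have fin: "finite (pverts (G \<boxtimes> H))"
    using G.pair_finite_verts H.pair_finite_verts by (simp add: strong_product_def)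
  have sub: "parcs (G \<boxtimes> H) \<subseteq> pverts (G \<boxtimes> H) \<times> pverts (G \<boxtimes> H)"
    by (auto simp: strong_product_def)
  have "finite (parcs (G \<boxtimes> H))"
    using sub by (rule finite_subset) (simp add: fin)
  moreover have "sym (parcs G)" "sym (parcs H)"
    using G.pair_sym_arcs H.pair_sym_arcs by (simp_all add: symmetric_def)
  then have "sym (parcs (G \<boxtimes> H))"
    unfolding strong_product_def sym_def by auto
  ultimately show ?thesis
    using fin by unfold_locales (auto simp: strong_product_def symmetric_def)
qed

lemma strong_grid_verts: "pverts (path_graph m \<boxtimes> path_graph n) = {..<m} \<times> {..<n}"
  by (simp add: strong_product_def path_graph_def)

lemma strong_grid_arcs:
  "((i, j), (i', j')) \<in> parcs (path_graph m \<boxtimes> path_graph n) \<longleftrightarrow>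
    i < m \<and> i' < m \<and> j < n \<and> j' < n \<and> (i, j) \<noteq> (i', j') \<and>
    \<bar>int i - int i'\<bar> \<le> 1 \<and> \<bar>int j - int j'\<bar> \<le> 1"
  by (auto simp: strong_product_def path_graph_def)


section \<open>The \<open>k\<close>-move deduction game\<close>

text \<open>
  The \<open>s\<close> searchers are the numbers below \<open>s\<close>.  A configuration records the position of every
  searcher, the number of moves it has made, and the set of protected vertices; its values at
  numbers that are at least \<open>s\<close> are irrelevant.
\<close>

record 'v config =
  position :: "nat \<Rightarrow> 'v"
  moves :: "nat \<Rightarrow> nat"
  protected :: "'v set"

definition unprotected_nbrs :: "'v pair_pre_digraph \<Rightarrow> 'v config \<Rightarrow> 'v \<Rightarrow> 'v set" where
  "unprotected_nbrs G c v = {u \<in> pverts G. (v, u) \<in> parcs G \<and> u \<notin> protected c}"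

definition mobile_on :: "nat \<Rightarrow> nat \<Rightarrow> 'v config \<Rightarrow> 'v \<Rightarrow> nat set" where
  "mobile_on k s c v = {i. i < s \<and> position c i = v \<and> moves c i < k}"

definition fires :: "nat \<Rightarrow> 'v pair_pre_digraph \<Rightarrow> nat \<Rightarrow> 'v config \<Rightarrow> 'v \<Rightarrow> bool" where
  "fires k G s c v \<longleftrightarrow> v \<in> pverts G \<and> unprotected_nbrs G c v \<noteq> {} \<and>
     card (unprotected_nbrs G c v) \<le> card (mobile_on k s c v)"

text \<open>
  In one stage every vertex that can fire must fire, all of them simultaneously.  \<open>M\<close> is the set
  of searchers that move and \<open>dest\<close> gives their destinations.  Which mobile searchers of a firing
  vertex go where, and which of the excess ones move at all, is left open, subject to every
  unprotected neighbour receiving a searcher.  A stage in which nobody moves is excluded: the game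
  is then over.
\<close>

inductive stage :: "nat \<Rightarrow> 'v pair_pre_digraph \<Rightarrow> nat \<Rightarrow> 'v config \<Rightarrow> 'v config \<Rightarrow> bool"
  for k G s c where
  "\<lbrakk> M \<noteq> {};
     \<And>i. i \<in> M \<Longrightarrow> i \<in> mobile_on k s c (position c i) \<and> fires k G s c (position c i) \<and>
                     dest i \<in> unprotected_nbrs G c (position c i);
     \<And>v u. fires k G s c v \<Longrightarrow> u \<in> unprotected_nbrs G c v \<Longrightarrow>
             \<exists>i\<in>M. position c i = v \<and> dest i = u \<rbrakk>
   \<Longrightarrow> stage k G s c
         \<lparr> position = (\<lambda>i. if i \<in> M then dest i else position c i),
           moves = (\<lambda>i. if i \<in> M then Suc (moves c i) else moves c i),
           protected = protected c \<union> dest ` M \<rparr>"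

definition layout :: "'v pair_pre_digraph \<Rightarrow> nat \<Rightarrow> (nat \<Rightarrow> 'v) \<Rightarrow> bool" where
  "layout G s L \<longleftrightarrow> L ` {..<s} \<subseteq> pverts G"

definition initial_config :: "nat \<Rightarrow> (nat \<Rightarrow> 'v) \<Rightarrow> 'v config" where
  "initial_config s L = \<lparr> position = L, moves = (\<lambda>_. 0), protected = L ` {..<s} \<rparr>"

text \<open>
  A layout is successful if the free choices of the searchers can be made so that every vertex
  ends up protected; once all vertices are protected no vertex can fire and the game has ended.
\<close>

definition successful :: "nat \<Rightarrow> 'v pair_pre_digraph \<Rightarrow> nat \<Rightarrow> (nat \<Rightarrow> 'v) \<Rightarrow> bool" where
  "successful k G s L \<longleftrightarrow>
     (\<exists>c. (stage k G s)\<^sup>*\<^sup>* (initial_config s L) c \<and> pverts G \<subseteq> protected c)"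

definition deduction_number :: "nat \<Rightarrow> 'v pair_pre_digraph \<Rightarrow> nat" where
  "deduction_number k G = (LEAST s. \<exists>L. layout G s L \<and> successful k G s L)"

text \<open>The minimum exists for every finite graph: put a searcher on each vertex.\<close>

lemma successful_layout_exists:
  assumes "finite (pverts G)"
  shows "\<exists>s L. layout G s L \<and> successful k G s L"
proof -
  obtain L where "bij_betw L {0..<card (pverts G)} (pverts G)"
    using ex_bij_betw_nat_finite[OF assms] by blast
  then have L: "L ` {..<card (pverts G)} = pverts G"
    by (simp add: bij_betw_def atLeast0LessThan)
  have "successful k G (card (pverts G)) L"
    unfolding successful_def using L
    by (intro exI[of _ "initial_config (card (pverts G)) L"]) (simp add: initial_config_def)
  moreover have "layout G (card (pverts G)) L"
    using L by (simp add: layout_def)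
  ultimately show ?thesis by blast
qed

end

theory Submission
  imports Defs
begin

text \<open>
  Lower bound. A boundary vertex of the protected set still carries a searcher, and a stage can be
  serialised so that vertices become protected one at a time while this remains true; hence \<open>s\<close>
  searchers yield a chain of sets, growing by single vertices, whose inner boundaries have at most
  \<open>s\<close> elements. Suppose \<open>s \<le> m\<close>. If every row meets both a set and its complement, then every row
  contains a boundary vertex; when there are only \<open>m\<close> of them, all rows meet the set equally often, so \<open>m\<close>
  divides the size of the set. The same holds for columns. Therefore each set in the chain whose
  size is not divisible by \<open>m\<close> has either an empty row and an empty column or a full row and a full
  column. The former is forced at size \<open>m + 1\<close> and the latter at size \<open>m n - 1\<close>, but adding at most
  two vertices cannot lead from the former to the latter.

  Upper bound. Put one searcher on each vertex of the first column and one more on its top vertex.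
  The extra searcher starts a cascade down the next column; at the bottom the last two searchers
  fire simultaneously into the same vertex, so the next column is again occupied with one end
  doubled, and the next cascade runs upwards. Every searcher moves at most once per column.
\<close>

section \<open>Inner boundaries in strong grids\<close>

abbreviation strong_grid :: "nat \<Rightarrow> nat \<Rightarrow> (nat \<times> nat) pair_pre_digraph" where
  "strong_grid m n \<equiv> path_graph m \<boxtimes> path_graph n"

definition inner_boundary :: "'v pair_pre_digraph \<Rightarrow> 'v set \<Rightarrow> 'v set" where
  "inner_boundary G W = {v \<in> W. \<exists>u \<in> pverts G - W. (v, u) \<in> parcs G}"

text \<open>Of the arc condition, distinctness and the range of \<open>(i, j)\<close> disappear: a
  member and a non-member of \<open>W\<close> differ, and \<open>W\<close> lies in the grid.\<close>

lemma inner_boundary_grid: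
  assumes "W \<subseteq> {..<m} \<times> {..<n}"
  shows "(i, j) \<in> inner_boundary (strong_grid m n) W \<longleftrightarrow> (i, j) \<in> W \<and>
    (\<exists>i'<m. \<exists>j'<n. (i', j') \<notin> W \<and> \<bar>int i - int i'\<bar> \<le> 1 \<and> \<bar>int j - int j'\<bar> \<le> 1)"
proof -
  have "(i, j) \<in> W \<Longrightarrow> i < m \<and> j < n" using assms by auto
  moreover have "(i, j) \<in> W \<Longrightarrow> (i', j') \<notin> W \<Longrightarrow> (i, j) \<noteq> (i', j')" for i' j' by auto
  ultimately show ?thesis
    unfolding inner_boundary_def strong_grid_verts mem_Collect_eq Bex_def split_paired_Ex strong_grid_arcs
    by (simp only: Diff_iff mem_Times_iff fst_conv snd_conv lessThan_iff) blast
qed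

text \<open>The converse relation is the transposed set, so statements about rows transfer to
  columns.\<close>

lemma inner_boundary_converse:
  assumes "W \<subseteq> {..<m} \<times> {..<n}"
  shows "inner_boundary (strong_grid n m) (W\<inverse>) = (inner_boundary (strong_grid m n) W)\<inverse>"
proof -
  have "W\<inverse> \<subseteq> {..<n} \<times> {..<m}" using assms by auto
  from inner_boundary_grid[OF this] inner_boundary_grid[OF assms] show ?thesis
    by (auto simp only: converse_iff set_eq_iff split_paired_all) blast+
qed

text \<open>Connectedness of a path.\<close>

lemma nbr_closed_interval:
  fixes S :: "nat set"
  assumes S: "S \<subseteq> {..<n}" "S \<noteq> {}"
    and closed: "\<And>j j'. j \<in> S \<Longrightarrow> j' < n \<Longrightarrow> \<bar>int j - int j'\<bar> \<le> 1 \<Longrightarrow> j' \<in> S"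
  shows "S = {..<n}"
proof -
  obtain a where a: "a \<in> S" using S by auto
  have up: "a + d < n \<Longrightarrow> a + d \<in> S" for d
  proof (induction d)
    case (Suc d)
    then show ?case by (intro closed[of "a + d" "a + Suc d"]) auto
  qed (simp add: a)
  have down: "d \<le> a \<Longrightarrow> a - d \<in> S" for d
  proof (induction d)
    case (Suc d)
    with a S have "a - d \<in> S" "a < n" by auto
    with Suc.prems show ?case by (intro closed[of "a - d" "a - Suc d"]) auto
  qed (simp add: a)
  have "j \<in> S" if "j < n" for j
    using up[of "j - a"] down[of "a - j"] that by (cases "a \<le> j") auto
  with S show ?thesis by auto
qed

section \<open>Row counts of sets with a small inner boundary\<close>

definition mixed_lines :: "nat \<Rightarrow> nat \<Rightarrow> (nat \<times> nat) set \<Rightarrow> bool" where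
  "mixed_lines m n W \<longleftrightarrow> (\<forall>i<m. W `` {i} \<noteq> {} \<and> W `` {i} \<noteq> {..<n})"

text \<open>By connectedness every mixed row contains a boundary vertex; with at most
  \<open>m\<close> of them there is exactly one, \<open>(i, b i)\<close>, per row. All other members
  of a row have their whole neighbourhood in \<open>W\<close>, which pushes the row into the
  adjacent ones.\<close>

lemma card_inner_boundary_mixed_lines:
  assumes W: "W \<subseteq> {..<m} \<times> {..<n}" and mixed: "mixed_lines m n W"
    and le: "card (inner_boundary (strong_grid m n) W) \<le> m"
  shows "card (inner_boundary (strong_grid m n) W) = m"
    and "i < m \<Longrightarrow> card (W `` {i}) = card (W `` {0})"
proof -
  let ?B = "inner_boundary (strong_grid m n) W"
  note bd = inner_boundary_grid[OF W]
  have finW: "finite W" using W finite_subset by blast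
  then have finB: "finite ?B" by (simp add: inner_boundary_def)
  have rowW: "W `` {i} \<subseteq> {..<n}" for i using W by auto
  have fin_row: "finite (W `` {i})" for i using rowW finite_subset by blast
  have "\<exists>j. (i, j) \<in> ?B" if i: "i < m" for i
  proof (rule ccontr)
    assume no: "\<nexists>j. (i, j) \<in> ?B"
    have "W `` {i} = {..<n}"
    proof (rule nbr_closed_interval[OF rowW])
      show "W `` {i} \<noteq> {}" using mixed i by (simp add: mixed_lines_def)
      show "j' \<in> W `` {i}" if "j \<in> W `` {i}" "j' < n" "\<bar>int j - int j'\<bar> \<le> 1" for j j'
        using no that i unfolding bd by fastforce
    qed
    then show False using mixed i by (simp add: mixed_lines_def)
  qed
  then obtain b where b: "\<And>i. i < m \<Longrightarrow> (i, b i) \<in> ?B" by metis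
  have sub: "(\<lambda>i. (i, b i)) ` {..<m} \<subseteq> ?B" using b by auto
  have card_img: "card ((\<lambda>i. (i, b i)) ` {..<m}) = m"
    by (subst card_image) (auto simp: inj_on_def)
  show cardB: "card ?B = m"
    using card_mono[OF finB sub] card_img le by simp
  have B: "?B = (\<lambda>i. (i, b i)) ` {..<m}"
    using card_subset_eq[OF finB sub] card_img cardB by simp
  have inner: "(i', j') \<in> W" if "(i, j) \<in> W" "j \<noteq> b i" "i' < m" "j' < n"
    "\<bar>int i - int i'\<bar> \<le> 1" "\<bar>int j - int j'\<bar> \<le> 1" for i j i' j'
  proof -
    have "(i, j) \<notin> ?B" using that B by auto
    with that show ?thesis unfolding bd by blast
  qed
  have bW: "b i \<in> W `` {i}" "b i < n" if "i < m" for i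
    using b[OF that] W unfolding bd by auto
  have mono: "card (W `` {i}) \<le> card (W `` {i'})"
    if i: "i < m" "i' < m" "\<bar>int i - int i'\<bar> \<le> 1" for i i'
  \<comment> \<open>A singleton row is trivially smallest, as no row is empty. Otherwise the row is
    contained in the adjacent one.\<close>
  proof (cases "W `` {i} = {b i}")
    case True
    have "W `` {i'} \<noteq> {}" using mixed i by (simp add: mixed_lines_def)
    then have "0 < card (W `` {i'})" using fin_row by (simp add: card_gt_0_iff del: Image_singleton_iff)
    with True show ?thesis by simp
  next
    case False
    \<comment> \<open>Otherwise the row without \<open>b i\<close> would be closed under neighbours
      and hence the full row, although it misses \<open>b i\<close>.\<close>
    have "\<exists>j \<in> W `` {i} - {b i}. \<bar>int j - int (b i)\<bar> \<le> 1"
    proof (rule ccontr)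
      assume no: "\<not> ?thesis"
      have "W `` {i} - {b i} = {..<n}"
      proof (rule nbr_closed_interval)
        show "W `` {i} - {b i} \<noteq> {}" using False bW[of i] i by auto
        show "j' \<in> W `` {i} - {b i}"
          if "j \<in> W `` {i} - {b i}" "j' < n" "\<bar>int j - int j'\<bar> \<le> 1" for j j'
          using inner[of i j i j'] no that i by auto
      qed (use rowW in auto)
      then show False using bW[of i] i by auto
    qed
    then obtain j where j: "(i, j) \<in> W" "j \<noteq> b i" "\<bar>int j - int (b i)\<bar> \<le> 1" by auto
    \<comment> \<open>The interior vertex \<open>(i, j)\<close> next to \<open>(i, b i)\<close>
      accounts for column \<open>b i\<close>; the other members of the row are interior
      themselves.\<close>
    have "W `` {i} \<subseteq> W `` {i'}"
    proof
      fix x assume x: "x \<in> W `` {i}"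
      then have "x < n" using rowW by blast
      then show "x \<in> W `` {i'}"
        using x i inner[of i x i' x] inner[of i j i' "b i"] j bW[of i] by (cases "x = b i") auto
    qed
    then show ?thesis by (rule card_mono[OF fin_row])
  qed
  show "i < m \<Longrightarrow> card (W `` {i}) = card (W `` {0})"
  proof (induction i)
    case (Suc i)
    then show ?case using mono[of i "Suc i"] mono[of "Suc i" i] by simp
  qed simp
qed

lemma mixed_lines_dvd_card:
  assumes W: "W \<subseteq> {..<m} \<times> {..<n}" and "mixed_lines m n W"
    and "card (inner_boundary (strong_grid m n) W) \<le> m"
  shows "m dvd card W"
proof -
  have "W = (SIGMA i:{..<m}. W `` {i})" using W by auto
  moreover have "finite (W `` {i})" for i using W finite_subset[OF W] by (simp add: finite_Image)
  ultimately have "card W = (\<Sum>i<m. card (W `` {i}))" using card_SigmaI by (metis finite_lessThan)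
  also have "\<dots> = (\<Sum>i<m. card (W `` {0}))"
    by (intro sum.cong refl card_inner_boundary_mixed_lines(2)[OF assms]) simp
  finally show ?thesis by simp
qed

lemma card_inner_boundary_converse:
  assumes "W \<subseteq> {..<m} \<times> {..<n}"
  shows "card (inner_boundary (strong_grid n m) (W\<inverse>)) = card (inner_boundary (strong_grid m n) W)"
  by (simp add: inner_boundary_converse[OF assms])

section \<open>Rows and columns that are entirely empty or entirely full\<close>

definition has_empty_lines :: "nat \<Rightarrow> nat \<Rightarrow> (nat \<times> nat) set \<Rightarrow> bool" where
  "has_empty_lines m n W \<longleftrightarrow> (\<exists>r<m. \<exists>c<n. (\<forall>j<n. (r, j) \<notin> W) \<and> (\<forall>i<m. (i, c) \<notin> W))"

definition has_full_lines :: "nat \<Rightarrow> nat \<Rightarrow> (nat \<times> nat) set \<Rightarrow> bool" where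
  "has_full_lines m n W \<longleftrightarrow> (\<exists>r<m. \<exists>c<n. (\<forall>j<n. (r, j) \<in> W) \<and> (\<forall>i<m. (i, c) \<in> W))"

text \<open>Neither the rows nor the columns can all be mixed, so some row and some column are each
  empty or full; their common vertex forces both to be of the same kind.\<close>

lemma empty_or_full_lines:
  assumes W: "W \<subseteq> {..<m} \<times> {..<n}" and "m \<le> n"
    and bd: "card (inner_boundary (strong_grid m n) W) \<le> m" and ndvd: "\<not> m dvd card W"
  shows "has_empty_lines m n W \<or> has_full_lines m n W"
proof -
  have W': "W\<inverse> \<subseteq> {..<n} \<times> {..<m}" using W by auto
  have bd': "card (inner_boundary (strong_grid n m) (W\<inverse>)) \<le> n"
    using bd \<open>m \<le> n\<close> card_inner_boundary_converse[OF W] by simp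
  have "\<not> mixed_lines m n W" using mixed_lines_dvd_card[OF W _ bd] ndvd by blast
  moreover have "\<not> mixed_lines n m (W\<inverse>)"
  proof
    assume mixed: "mixed_lines n m (W\<inverse>)"
    \<comment> \<open>Mixed columns need exactly \<open>n\<close> boundary vertices, but there are
      at most \<open>m\<close>.\<close>
    have "n = m"
      using card_inner_boundary_mixed_lines(1)[OF W' mixed bd'] bd \<open>m \<le> n\<close>
        card_inner_boundary_converse[OF W] by simp
    then show False using mixed_lines_dvd_card[OF W' mixed bd'] ndvd by simp
  qed
  ultimately obtain r c where rc: "r < m" "c < n"
    "W `` {r} = {} \<or> W `` {r} = {..<n}" "W\<inverse> `` {c} = {} \<or> W\<inverse> `` {c} = {..<m}"
    unfolding mixed_lines_def by blast
  have "(r, c) \<in> W \<longleftrightarrow> W `` {r} \<noteq> {}" "(r, c) \<in> W \<longleftrightarrow> W\<inverse> `` {c} \<noteq> {}" using rc by blast+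
  then consider "W `` {r} = {}" "W\<inverse> `` {c} = {}" | "W `` {r} = {..<n}" "W\<inverse> `` {c} = {..<m}"
    using rc by argo
  then show ?thesis
  proof cases
    case 1
    then have "has_empty_lines m n W" using rc(1,2) unfolding has_empty_lines_def by blast
    then show ?thesis ..
  next
    case 2
    then have "has_full_lines m n W" using rc(1,2) unfolding has_full_lines_def by blast
    then show ?thesis ..
  qed
qed

lemma card_has_full_lines:
  assumes "W \<subseteq> {..<m} \<times> {..<n}" "has_full_lines m n W"
  shows "m + n \<le> card W + 1"
proof -
  obtain r c where rc: "r < m" "c < n" "\<forall>j<n. (r, j) \<in> W" "\<forall>i<m. (i, c) \<in> W"
    using assms(2) by (auto simp: has_full_lines_def)
  have "m + n = card ({r} \<times> {..<n}) + card ({..<m} \<times> {c})" by (simp add: card_cartesian_product)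
  also have "\<dots> = card ({r} \<times> {..<n} \<union> {..<m} \<times> {c}) + card ({r} \<times> {..<n} \<inter> {..<m} \<times> {c})"
    by (rule card_Un_Int) auto
  also have "{r} \<times> {..<n} \<inter> {..<m} \<times> {c} = {(r, c)}" using rc by auto
  also have "card ({r} \<times> {..<n} \<union> {..<m} \<times> {c}) \<le> card W"
    using rc assms(1) by (intro card_mono) (auto intro: finite_subset)
  finally show ?thesis by simp
qed

lemma ex_third:
  assumes "3 \<le> (n::nat)" shows "\<exists>j<n. j \<noteq> a \<and> j \<noteq> b"
proof (rule ccontr)
  assume "\<not> ?thesis"
  then have "{..<n} \<subseteq> {a, b}" by auto
  then have "card {..<n} \<le> card {a, b}" by (intro card_mono) auto
  also have "\<dots> \<le> 2" by (simp add: card_insert_if)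
  finally show False using assms by simp
qed

text \<open>Column \<open>c'\<close> is full and column \<open>c\<close> empty, so all rows are
  mixed and must meet \<open>W\<close> equally often. But row \<open>r\<close> meets it once and row
  \<open>r'\<close> at least twice, as \<open>3 \<le> n\<close>.\<close>

lemma crossing_lines:
  assumes W: "W \<subseteq> {..<m} \<times> {..<n}" and "3 \<le> n"
    and bd: "card (inner_boundary (strong_grid m n) W) \<le> m"
    and rc: "r < m" "c' < n" "r' < m" "c < n" "c \<noteq> c'"
    and empty: "\<forall>i<m. (i, c) \<notin> W" "\<forall>j<n. (r, j) \<in> W \<longrightarrow> j = c'"
    and full: "\<forall>i<m. (i, c') \<in> W" "\<forall>j<n. j \<noteq> c \<longrightarrow> (r', j) \<in> W"
  shows False
proof -
  have "mixed_lines m n W"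
    unfolding mixed_lines_def using full(1) empty(1) rc by blast
  from card_inner_boundary_mixed_lines(2)[OF W this bd]
  have eq: "card (W `` {r}) = card (W `` {r'})" using rc by metis
  have "j < n" if "(r, j) \<in> W" for j using that W by auto
  then have "W `` {r} = {c'}" using rc(1) empty(2) full(1) by blast
  then have "card (W `` {r'}) = 1" using eq by simp
  moreover obtain j where "j < n" "j \<noteq> c" "j \<noteq> c'" using ex_third[OF \<open>3 \<le> n\<close>] by metis
  then have "j \<in> W `` {r'}" "c' \<in> W `` {r'}" "j \<noteq> c'" using full rc by auto
  ultimately show False by (metis card_1_singletonE singletonD)
qed

text \<open>Two vertices cannot fill an empty line of length at least 3, so the empty lines
  \<open>r\<close>, \<open>c\<close> differ from the full lines \<open>r'\<close>,
  \<open>c'\<close>. The crossings \<open>(r', c)\<close> and \<open>(r, c')\<close> must then be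
  the two added vertices, and the intermediate set contradicts \<open>crossing_lines\<close>,
  directly or transposed.\<close>

lemma no_jump_empty_full:
  assumes W: "insert x W \<subseteq> {..<m} \<times> {..<n}" and mn: "3 \<le> m" "m \<le> n"
    and bd: "card (inner_boundary (strong_grid m n) (insert x W)) \<le> m"
    and e: "has_empty_lines m n W" and f: "has_full_lines m n (insert y (insert x W))"
  shows False
proof -
  obtain r c where e: "r < m" "c < n" "\<forall>j<n. (r, j) \<notin> W" "\<forall>i<m. (i, c) \<notin> W"
    using e by (auto simp: has_empty_lines_def)
  obtain r' c' where f: "r' < m" "c' < n" "\<forall>j<n. (r', j) \<in> insert y (insert x W)"
    "\<forall>i<m. (i, c') \<in> insert y (insert x W)"
    using f by (auto simp: has_full_lines_def)
  have "r \<noteq> r'"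
  proof
    assume "r = r'"
    obtain j where "j < n" "j \<noteq> snd x" "j \<noteq> snd y" using ex_third[of n] mn by auto
    then show False using e f \<open>r = r'\<close> by auto
  qed
  have "c \<noteq> c'"
  proof
    assume "c = c'"
    obtain i where "i < m" "i \<noteq> fst x" "i \<noteq> fst y" using ex_third[of m] mn by auto
    then show False using e f \<open>c = c'\<close> by auto
  qed
  have "(r', c) \<in> {x, y}" "(r, c') \<in> {x, y}" using e f by auto
  then consider "x = (r, c')" "y = (r', c)" | "x = (r', c)" "y = (r, c')"
    using \<open>r \<noteq> r'\<close> by auto
  then show False
  proof cases
    case 1
    show ?thesis
      by (rule crossing_lines[OF W _ bd, of r c' r' c]) (use 1 e f mn \<open>r \<noteq> r'\<close> \<open>c \<noteq> c'\<close> in auto)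
  next
    case 2
    have W': "(insert x W)\<inverse> \<subseteq> {..<n} \<times> {..<m}" using W by auto
    have bd': "card (inner_boundary (strong_grid n m) ((insert x W)\<inverse>)) \<le> n"
      using bd mn card_inner_boundary_converse[OF W] by simp
    show ?thesis
      by (rule crossing_lines[OF W' _ bd', of c r' c' r]) (use 2 e f mn \<open>r \<noteq> r'\<close> \<open>c \<noteq> c'\<close> in auto)
  qed
qed

section \<open>Chains of sets growing by single vertices\<close>

definition grow :: "'v pair_pre_digraph \<Rightarrow> nat \<Rightarrow> 'v set \<Rightarrow> 'v set \<Rightarrow> bool" where
  "grow G s P P' \<longleftrightarrow>
     (\<exists>x \<in> pverts G - P. P' = insert x P \<and> card (inner_boundary G P') \<le> s)"

lemma no_grow_strong_grid:
  assumes mn: "3 \<le> m" "m \<le> n" and P\<^sub>0: "P\<^sub>0 \<subseteq> {..<m} \<times> {..<n}" "card P\<^sub>0 \<le> m"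
  shows "\<not> (grow (strong_grid m n) m)\<^sup>*\<^sup>* P\<^sub>0 ({..<m} \<times> {..<n})"
proof
  let ?V = "{..<m} \<times> {..<n}"
  \<comment> \<open>Nothing is known about a set whose size is a multiple of \<open>m\<close>, so
    there the invariant only remembers that removing one vertex gives empty lines.\<close>
  define inv where "inv P \<longleftrightarrow> card P \<le> m \<or> has_empty_lines m n P \<or>
    (m dvd card P \<and> (\<exists>x Q. has_empty_lines m n Q \<and> P = insert x Q))" for P
  let ?bd = "\<lambda>P. card (inner_boundary (strong_grid m n) P)"
  have "P \<subseteq> ?V \<and> ?bd P \<le> m \<and> inv P"
    if "(grow (strong_grid m n) m)\<^sup>*\<^sup>* P\<^sub>0 P" for P
    using that
  proof (induction rule: rtranclp_induct)
    case base
    \<comment> \<open>\<open>grow\<close> bounds the boundary of the set reached only; for the first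
      set the bound comes from its size.\<close>
    have "?bd P\<^sub>0 \<le> card P\<^sub>0"
      using P\<^sub>0 finite_subset by (intro card_mono) (auto simp: inner_boundary_def)
    then show ?case using P\<^sub>0 by (auto simp: inv_def)
  next
    case (step P P1)
    then obtain y where y: "y \<in> ?V" "y \<notin> P" "P1 = insert y P" "?bd P1 \<le> m"
      by (auto simp: grow_def strong_grid_verts)
    have P1: "P1 \<subseteq> ?V" using step y by auto
    have "finite P" using step finite_subset by blast
    then have card_P1: "card P1 = Suc (card P)" using y by simp
    have "inv P1"
    proof (cases "card P1 \<le> m")
      case large: False
      have step_inv: "inv P" "P \<subseteq> ?V" "?bd P \<le> m" using step by auto
      show ?thesis
      proof (cases "m dvd card P1")
        case True
        \<comment> \<open>Since \<open>m > 1\<close>, two consecutive sizes are never both multiples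
          of \<open>m\<close>, so the third clause of the invariant cannot hold for
          \<open>P\<close>.\<close>
        have "\<not> m dvd card P"
        proof
          assume "m dvd card P"
          then have "m dvd 1" using True card_P1 dvd_add_right_iff[of m "card P" 1] by simp
          then show False using mn by simp
        qed
        moreover from this have "card P \<noteq> m" by auto
        ultimately have "has_empty_lines m n P"
          using step_inv large card_P1 by (simp add: inv_def)
        then show ?thesis using True y by (auto simp: inv_def)
      next
        case False
        have "\<not> has_full_lines m n P1"
        proof
          assume f: "has_full_lines m n P1"
          \<comment> \<open>Full lines use \<open>m + n - 1\<close> vertices, so \<open>P\<close>
            has at least \<open>m + n - 2\<close>, which exceeds \<open>m\<close>.\<close>
          then have "m < card P" using card_has_full_lines[OF P1] mn card_P1 by simp
          \<comment> \<open>If \<open>P\<close> itself has empty lines, \<open>Q = P\<close> serves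
            with any \<open>x\<close> in the nonempty set \<open>P\<close>.\<close>
          then have "\<exists>x Q. has_empty_lines m n Q \<and> P = insert x Q"
            using step_inv(1) unfolding inv_def
            by (metis card.empty insert_absorb ex_in_conv not_less0 leD)
          then obtain x Q where "has_empty_lines m n Q" "P = insert x Q" by blast
          then show False
            using no_jump_empty_full[of x Q m n y] step_inv mn f y by simp
        qed
        then show ?thesis
          using empty_or_full_lines[OF P1 \<open>m \<le> n\<close> y(4) False] by (simp add: inv_def)
      qed
    qed (simp add: inv_def)
    then show ?case using P1 y by simp
  qed
  moreover assume "(grow (strong_grid m n) m)\<^sup>*\<^sup>* P\<^sub>0 ?V"
  ultimately have "inv ?V" by blast
  moreover have "\<not> card ?V \<le> m" using mn by (simp add: card_cartesian_product)
  ultimately consider "has_empty_lines m n ?V"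
    | x Q where "has_empty_lines m n Q" "?V = insert x Q"
    unfolding inv_def by auto
  then show False
  proof cases
    case 1
    then show ?thesis by (auto simp: has_empty_lines_def)
  next
    case 2
    then obtain r where r: "r < m" "\<forall>j<n. (r, j) \<notin> Q" by (auto simp: has_empty_lines_def)
    \<comment> \<open>A single vertex cannot fill an empty row that has at least two places.\<close>
    have "(r, 0) \<in> insert x Q" "(r, 1) \<in> insert x Q" using r mn unfolding 2(2)[symmetric] by auto
    then show False using r mn by auto
  qed
qed


section \<open>Stages grow the protected set vertex by vertex\<close>

definition boundary_occupied :: "'v pair_pre_digraph \<Rightarrow> nat \<Rightarrow> 'v config \<Rightarrow> bool" where
  "boundary_occupied G s c \<longleftrightarrow> inner_boundary G (protected c) \<subseteq> position c ` {..<s}"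

text \<open>The moves are carried out one at a time, in any order: \<open>P M'\<close> and
  \<open>pos M'\<close> describe the situation after exactly the searchers in \<open>M'\<close> have
  moved, and even then every boundary vertex holds a searcher.\<close>

lemma stage_grow:
  assumes "stage k G s c c'" and occ: "boundary_occupied G s c"
  shows "(grow G s)\<^sup>*\<^sup>* (protected c) (protected c') \<and> boundary_occupied G s c'"
  using assms(1)
proof cases
  case (1 M dest)
  define P where "P M' = protected c \<union> dest ` M'" for M'
  define pos where "pos M' i = (if i \<in> M' then dest i else position c i)" for M' i
  have Ms: "M \<subseteq> {..<s}" using 1(3) by (auto simp: mobile_on_def)
  have cover: "inner_boundary G (P M') \<subseteq> pos M' ` {..<s}" if M': "M' \<subseteq> M" for M'
  proof
    fix v assume v: "v \<in> inner_boundary G (P M')"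
    then obtain w where w: "w \<in> pverts G" "w \<notin> P M'" "(v, w) \<in> parcs G"
      by (auto simp: inner_boundary_def)
    show "v \<in> pos M' ` {..<s}"
    proof (cases "v \<in> dest ` M'")
      case True
      then show ?thesis using M' Ms by (force simp: pos_def)
    next
      case False
      with v have "v \<in> protected c" by (auto simp: inner_boundary_def P_def)
      with w have "v \<in> inner_boundary G (protected c)" by (auto simp: inner_boundary_def P_def)
      then obtain i where i: "i < s" "position c i = v"
        using occ by (auto simp: boundary_occupied_def)
      show ?thesis
      \<comment> \<open>A vertex that does not fire keeps its searchers; one that fires still holds
        the searcher destined for the unprotected neighbour \<open>w\<close>.\<close>
      proof (cases "fires k G s c v")
        case True
        moreover have "w \<in> unprotected_nbrs G c v" using w by (auto simp: unprotected_nbrs_def P_def)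
        ultimately obtain l where "l \<in> M" "position c l = v" "dest l = w" using 1(4) by blast
        moreover from this have "l \<notin> M'" using w by (auto simp: P_def)
        ultimately show ?thesis using Ms by (force simp: pos_def)
      next
        case False
        then have "i \<notin> M'" using 1(3) i M' by blast
        then show ?thesis using i by (force simp: pos_def)
      qed
    qed
  qed
  have "finite M" using finite_subset[OF Ms] by simp
  have "(grow G s)\<^sup>*\<^sup>* (protected c) (P M') \<and> M' \<subseteq> M" if "M' \<subseteq> M" for M'
    using finite_subset[OF that \<open>finite M\<close>] that
  proof (induction M' rule: finite_subset_induct)
    case empty
    then show ?case by (simp add: P_def)
  next
    case (insert i M')
    then have sub: "insert i M' \<subseteq> M" by blast
    have "card (inner_boundary G (P (insert i M'))) \<le> card (pos (insert i M') ` {..<s})"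
      by (intro card_mono cover sub) simp
    also have "\<dots> \<le> s" using card_image_le[of "{..<s}"] by simp
    finally have "card (inner_boundary G (P (insert i M'))) \<le> s" .
    moreover have "P (insert i M') = insert (dest i) (P M')" by (auto simp: P_def)
    moreover have "dest i \<in> pverts G" using 1(3) sub by (auto simp: unprotected_nbrs_def)
    \<comment> \<open>Searchers may share a destination, so a single move may protect nothing
      new.\<close>
    ultimately have "P (insert i M') = P M' \<or> grow G s (P M') (P (insert i M'))"
      by (auto simp: grow_def)
    then show ?case using insert.IH sub by (auto intro: rtranclp.rtrancl_into_rtrancl)
  qed
  moreover have "boundary_occupied G s c'"
    using cover[of M] unfolding boundary_occupied_def 1(1) by (simp add: P_def pos_def)
  ultimately show ?thesis unfolding 1(1) by (simp add: P_def)
qed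

lemma successful_grow:
  assumes "layout G s L" "successful k G s L"
  shows "(grow G s)\<^sup>*\<^sup>* (L ` {..<s}) (pverts G)"
proof -
  obtain c where c: "(stage k G s)\<^sup>*\<^sup>* (initial_config s L) c" "pverts G \<subseteq> protected c"
    using assms(2) by (auto simp: successful_def)
  from c(1) have "(grow G s)\<^sup>*\<^sup>* (L ` {..<s}) (protected c) \<and> boundary_occupied G s c"
  proof (induction rule: rtranclp_induct)
    case base
    show ?case by (auto simp: boundary_occupied_def initial_config_def inner_boundary_def)
  next
    case (step c c')
    then show ?case using stage_grow[of k G s c c'] by (auto intro: rtranclp_trans)
  qed
  moreover have "P \<subseteq> pverts G" if "(grow G s)\<^sup>*\<^sup>* (L ` {..<s}) P" for P
    using that by (induction rule: rtranclp_induct) (use assms(1) in \<open>auto simp: layout_def grow_def\<close>)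
  ultimately show ?thesis using c(2) by (metis subset_antisym)
qed


section \<open>Winning play and symmetry\<close>

text \<open>From each firing vertex exactly one searcher per unprotected neighbour is sent, chosen
  by an injection \<open>g v\<close> that the destination map inverts; excess searchers
  stay.\<close>

lemma stage_exists:
  assumes fin: "finite (pverts G)" and v: "fires k G s c v"
  shows "\<exists>c'. stage k G s c c'"
proof -
  have "\<exists>g. inj_on g (unprotected_nbrs G c v) \<and>
      g ` unprotected_nbrs G c v \<subseteq> mobile_on k s c v" if "fires k G s c v" for v
  proof -
    have "finite (unprotected_nbrs G c v)" "finite (mobile_on k s c v)"
      using fin by (auto simp: unprotected_nbrs_def mobile_on_def)
    then show ?thesis using card_le_inj[of _ "mobile_on k s c v"] that
      unfolding fires_def by blast
  qed
  then obtain g where g: "\<And>v. fires k G s c v \<Longrightarrow> inj_on (g v) (unprotected_nbrs G c v)"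
    "\<And>v. fires k G s c v \<Longrightarrow> g v ` unprotected_nbrs G c v \<subseteq> mobile_on k s c v"
    by metis
  define M where "M = {g v u | v u. fires k G s c v \<and> u \<in> unprotected_nbrs G c v}"
  define dest where "dest i = the_inv_into (unprotected_nbrs G c (position c i)) (g (position c i)) i" for i
  have pos: "position c (g v u) = v" "g v u \<in> mobile_on k s c v"
    if "fires k G s c v" "u \<in> unprotected_nbrs G c v" for v u
    using g(2)[OF that(1)] that(2) by (auto simp: mobile_on_def)
  have dest: "dest (g v u) = u" if "fires k G s c v" "u \<in> unprotected_nbrs G c v" for v u
    unfolding dest_def pos(1)[OF that] using the_inv_into_f_f[OF g(1)[OF that(1)] that(2)] .
  have "stage k G s c
     \<lparr> position = (\<lambda>i. if i \<in> M then dest i else position c i),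
       moves = (\<lambda>i. if i \<in> M then Suc (moves c i) else moves c i),
       protected = protected c \<union> dest ` M \<rparr>"
  proof (rule stage.intros)
    show "M \<noteq> {}" using v by (auto simp: M_def fires_def)
  next
    fix i assume "i \<in> M"
    then obtain v u where "i = g v u" "fires k G s c v" "u \<in> unprotected_nbrs G c v"
      by (auto simp: M_def)
    then show "i \<in> mobile_on k s c (position c i) \<and> fires k G s c (position c i) \<and>
        dest i \<in> unprotected_nbrs G c (position c i)"
      by (simp add: pos dest)
  next
    fix v u assume "fires k G s c v" "u \<in> unprotected_nbrs G c v"
    then show "\<exists>i\<in>M. position c i = v \<and> dest i = u"
      by (intro bexI[of _ "g v u"]) (auto simp: pos dest M_def)
  qed
  then show ?thesis by blast
qed

lemma stage_protected_psubset:
  assumes "stage k G s c c'" shows "protected c \<subset> protected c'"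
  using assms
proof cases
  case (1 M dest)
  then obtain i where "i \<in> M" by blast
  with 1(3) have "dest i \<notin> protected c" by (auto simp: unprotected_nbrs_def)
  with \<open>i \<in> M\<close> show ?thesis unfolding 1(1) by auto
qed

lemma stage_protected_subset:
  assumes "stage k G s c c'" "protected c \<subseteq> pverts G" shows "protected c' \<subseteq> pverts G"
  using assms by cases (auto simp: unprotected_nbrs_def)

lemma stage_fires:
  assumes "stage k G s c c'" "fires k G s c v" "u \<in> pverts G" "(v, u) \<in> parcs G"
  shows "u \<in> protected c'"
  using assms(1)
proof cases
  case (1 M dest)
  then show ?thesis
  proof (cases "u \<in> protected c")
    case False
    then have "u \<in> unprotected_nbrs G c v" using assms by (simp add: unprotected_nbrs_def)
    then show ?thesis using 1 assms(2) by force
  qed simp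
qed

lemma stage_not_fires:
  assumes "stage k G s c c'" "\<not> fires k G s c v"
  shows "mobile_on k s c v \<subseteq> mobile_on k s c' v"
  using assms(1)
proof cases
  case (1 M dest)
  then have "i \<notin> M" if "position c i = v" for i using assms(2) that by blast
  then show ?thesis using 1 by (auto simp: mobile_on_def)
qed

section \<open>Winning configurations\<close>

definition win :: "nat \<Rightarrow> 'v pair_pre_digraph \<Rightarrow> nat \<Rightarrow> 'v config \<Rightarrow> bool" where
  "win k G s c \<longleftrightarrow> (\<exists>c'. (stage k G s)\<^sup>*\<^sup>* c c' \<and> pverts G \<subseteq> protected c')"

lemma win_stages: "(stage k G s)\<^sup>*\<^sup>* c c' \<Longrightarrow> win k G s c' \<Longrightarrow> win k G s c"
  unfolding win_def by (meson rtranclp_trans)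

text \<open>The set of unprotected vertices shrinks strictly at every stage, so it suffices that
  play never gets stuck. This wins without tracking which vertices fire.\<close>

lemma win_by_invariant:
  assumes fin: "finite (pverts G)"
    and pres: "\<And>c c'. I c \<Longrightarrow> stage k G s c c' \<Longrightarrow> I c'"
    and prog: "\<And>c. I c \<Longrightarrow> \<not> pverts G \<subseteq> protected c \<Longrightarrow> \<exists>v. fires k G s c v"
    and "I c" "protected c \<subseteq> pverts G"
  shows "win k G s c"
  using assms(4,5)
proof (induction "card (pverts G - protected c)" arbitrary: c rule: less_induct)
  case less
  show ?case
  proof (cases "pverts G \<subseteq> protected c")
    case True
    then show ?thesis unfolding win_def by blast
  next
    case False
    then obtain c' where c': "stage k G s c c'" using prog stage_exists[OF fin] less by meson
    have sub: "protected c' \<subseteq> pverts G" using stage_protected_subset[OF c'] less by blast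
    have "card (pverts G - protected c') < card (pverts G - protected c)"
      using stage_protected_psubset[OF c'] sub fin by (intro psubset_card_mono) auto
    then have "win k G s c'" using less pres c' sub by blast
    then show ?thesis using c' win_stages by (metis r_into_rtranclp)
  qed
qed

section \<open>Transport of plays along symmetries\<close>

definition transport :: "('v \<Rightarrow> 'v) \<Rightarrow> (nat \<Rightarrow> nat) \<Rightarrow> 'v config \<Rightarrow> 'v config" where
  "transport \<phi> \<pi> c = \<lparr>position = \<phi> \<circ> position c \<circ> \<pi>, moves = moves c \<circ> \<pi>, protected = \<phi> ` protected c\<rparr>"

text \<open>Involutions make image and preimage agree, so the same maps carry a play over and
  back.\<close>

locale game_symmetry =
  fixes G :: "'v pair_pre_digraph" and s :: nat and \<phi> :: "'v \<Rightarrow> 'v" and \<pi> :: "nat \<Rightarrow> nat"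
  assumes phi_invol: "\<phi> (\<phi> v) = v" and phi_verts: "v \<in> pverts G \<Longrightarrow> \<phi> v \<in> pverts G"
    and phi_arcs: "(v, u) \<in> parcs G \<Longrightarrow> (\<phi> v, \<phi> u) \<in> parcs G"
    and pi_invol: "\<pi> (\<pi> i) = i" and pi_less: "i < s \<Longrightarrow> \<pi> i < s"
begin

lemma inj_phi: "inj_on \<phi> A" and inj_pi: "inj_on \<pi> B"
  by (metis inj_onI phi_invol) (metis inj_onI pi_invol)

lemma image_phi: "v \<in> \<phi> ` A \<longleftrightarrow> \<phi> v \<in> A" and image_pi: "i \<in> \<pi> ` B \<longleftrightarrow> \<pi> i \<in> B"
  by (metis image_iff phi_invol) (metis image_iff pi_invol)

lemma verts_iff: "\<phi> v \<in> pverts G \<longleftrightarrow> v \<in> pverts G"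
  and arcs_iff: "(\<phi> v, u) \<in> parcs G \<longleftrightarrow> (v, \<phi> u) \<in> parcs G"
  by (metis phi_verts phi_invol) (metis phi_arcs phi_invol)

lemma pi_less_iff: "\<pi> i < s \<longleftrightarrow> i < s"
  by (metis pi_less pi_invol)

lemma phi_eq_iff: "\<phi> u = v \<longleftrightarrow> u = \<phi> v"
  by (metis phi_invol)

lemma unprotected_nbrs_transport:
  "unprotected_nbrs G (transport \<phi> \<pi> c) v = \<phi> ` unprotected_nbrs G c (\<phi> v)"
  by (auto simp: set_eq_iff image_phi unprotected_nbrs_def transport_def verts_iff arcs_iff phi_invol)

lemma mobile_on_transport:
  "mobile_on k s (transport \<phi> \<pi> c) v = \<pi> ` mobile_on k s c (\<phi> v)"
  by (auto simp: set_eq_iff image_pi mobile_on_def transport_def pi_less_iff phi_eq_iff)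

lemma fires_transport: "fires k G s (transport \<phi> \<pi> c) v \<longleftrightarrow> fires k G s c (\<phi> v)"
  by (simp add: fires_def unprotected_nbrs_transport mobile_on_transport card_image inj_phi inj_pi verts_iff)

lemma stage_transport:
  assumes "stage k G s c c'"
  shows "stage k G s (transport \<phi> \<pi> c) (transport \<phi> \<pi> c')"
  using assms
proof cases
  case (1 M dest)
  let ?c = "transport \<phi> \<pi> c" and ?M = "\<pi> ` M" and ?dest = "\<phi> \<circ> dest \<circ> \<pi>"
  have pos: "position ?c i = \<phi> (position c (\<pi> i))" for i by (simp add: transport_def)
  have "stage k G s ?c
     \<lparr> position = (\<lambda>i. if i \<in> ?M then ?dest i else position ?c i),
       moves = (\<lambda>i. if i \<in> ?M then Suc (moves ?c i) else moves ?c i),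
       protected = protected ?c \<union> ?dest ` ?M \<rparr>"
  proof (rule stage.intros)
    show "?M \<noteq> {}" using 1 by simp
  next
    fix i assume "i \<in> ?M"
    then have "\<pi> i \<in> M" by (simp add: image_pi)
    from 1(3)[OF this] show "i \<in> mobile_on k s ?c (position ?c i) \<and> fires k G s ?c (position ?c i) \<and>
        ?dest i \<in> unprotected_nbrs G ?c (position ?c i)"
      by (simp add: unprotected_nbrs_transport mobile_on_transport fires_transport pos phi_invol
          image_phi image_pi)
  next
    fix v u assume "fires k G s ?c v" "u \<in> unprotected_nbrs G ?c v"
    then have "fires k G s c (\<phi> v)" "\<phi> u \<in> unprotected_nbrs G c (\<phi> v)"
      by (simp_all add: fires_transport unprotected_nbrs_transport image_phi)
    then obtain i where "i \<in> M" "position c i = \<phi> v" "dest i = \<phi> u" using 1(4) by blast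
    then show "\<exists>i\<in>?M. position ?c i = v \<and> ?dest i = u"
      by (intro bexI[of _ "\<pi> i"]) (auto simp: pos pi_invol phi_invol)
  qed
  also have "\<lparr> position = (\<lambda>i. if i \<in> ?M then ?dest i else position ?c i),
       moves = (\<lambda>i. if i \<in> ?M then Suc (moves ?c i) else moves ?c i),
       protected = protected ?c \<union> ?dest ` ?M \<rparr> = transport \<phi> \<pi> c'"
    unfolding 1(1) by (auto simp: transport_def image_pi fun_eq_iff image_Un image_image pi_invol)
  finally show ?thesis .
qed

text \<open>\<open>transport\<close> undoes itself, so a winning play from the image is carried back
  to one from \<open>c\<close>.\<close>

lemma win_transport:
  assumes "win k G s (transport \<phi> \<pi> c)" shows "win k G s c"
proof -
  obtain c' where c': "(stage k G s)\<^sup>*\<^sup>* (transport \<phi> \<pi> c) c'" "pverts G \<subseteq> protected c'"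
    using assms by (auto simp: win_def)
  have "transport \<phi> \<pi> (transport \<phi> \<pi> c) = c"
    by (simp add: transport_def fun_eq_iff phi_invol pi_invol image_image comp_def)
  moreover from c'(1) have "(stage k G s)\<^sup>*\<^sup>* (transport \<phi> \<pi> (transport \<phi> \<pi> c)) (transport \<phi> \<pi> c')"
    by (induction rule: rtranclp_induct) (auto intro: stage_transport rtranclp.rtrancl_into_rtrancl)
  moreover have "pverts G \<subseteq> protected (transport \<phi> \<pi> c')"
    using c'(2) by (auto simp: transport_def image_phi dest: phi_verts)
  ultimately show ?thesis unfolding win_def by metis
qed

end


section \<open>Sweeping the strong grid\<close>

lemma finite_strong_grid: "finite (pverts (strong_grid m n))"
  by (simp add: strong_grid_verts)

lemma unprotected_nbrs_grid:
  "(i', j') \<in> unprotected_nbrs (strong_grid m n) c (i, j) \<longleftrightarrow>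
     i < m \<and> i' < m \<and> j < n \<and> j' < n \<and> (i, j) \<noteq> (i', j') \<and>
     \<bar>int i - int i'\<bar> \<le> 1 \<and> \<bar>int j - int j'\<bar> \<le> 1 \<and> (i', j') \<notin> protected c"
  unfolding unprotected_nbrs_def mem_Collect_eq strong_grid_arcs strong_grid_verts by auto

lemma firesI:
  assumes "v \<in> pverts G" "unprotected_nbrs G c v \<noteq> {}" "unprotected_nbrs G c v \<subseteq> A"
    "finite A" "card A \<le> card (mobile_on k s c v)"
  shows "fires k G s c v"
  using assms card_mono[of A "unprotected_nbrs G c v"] by (simp add: fires_def)

lemma not_firesI:
  assumes "finite (pverts G)" "mobile_on k s c v \<subseteq> {l}"
    "a \<in> unprotected_nbrs G c v" "b \<in> unprotected_nbrs G c v" "a \<noteq> b"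
  shows "\<not> fires k G s c v"
proof -
  have "finite (unprotected_nbrs G c v)" using assms(1) by (simp add: unprotected_nbrs_def)
  then have "card {a, b} \<le> card (unprotected_nbrs G c v)" using assms by (intro card_mono) auto
  moreover have "card (mobile_on k s c v) \<le> card {l}" using assms(2) by (intro card_mono) auto
  ultimately show ?thesis using assms(5) by (simp add: fires_def)
qed

lemma fires_mobile:
  assumes "finite (pverts G)" "fires k G s c v"
  obtains l where "l < s" "position c l = v"
proof -
  have "finite (unprotected_nbrs G c v)" using assms(1) by (simp add: unprotected_nbrs_def)
  then have "mobile_on k s c v \<noteq> {}" using assms(2) by (auto simp: fires_def)
  then show ?thesis using that by (auto simp: mobile_on_def)
qed

text \<open>
  Searcher \<open>l\<close> starts in row \<open>l - 1\<close>, where truncated subtraction puts searchers 0 and 1 in row 0,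
  and arrives in row \<open>min l (m - 1)\<close> of the next column. Reflecting the rows and renaming \<open>l\<close> to
  \<open>m - l\<close> turns the arrival into a start. After stage \<open>t\<close> of the cascade exactly the searchers up
  to \<open>t\<close> have moved.
\<close>

definition sweep_start :: "nat \<Rightarrow> nat \<Rightarrow> (nat \<times> nat) config \<Rightarrow> bool" where
  "sweep_start m j c \<longleftrightarrow> (\<forall>l\<le>m. position c l = (l - 1, j) \<and> moves c l = j) \<and>
     protected c = {..<m} \<times> {..j}"

definition sweep :: "nat \<Rightarrow> nat \<Rightarrow> nat \<Rightarrow> (nat \<times> nat) config \<Rightarrow> bool" where
  "sweep m j t c \<longleftrightarrow>
     (\<forall>l\<le>m. position c l = (if l \<le> t then (l, j + 1) else (l - 1, j)) \<and>
       moves c l = (if l \<le> t then j + 1 else j)) \<and>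
     protected c = {..<m} \<times> {..j} \<union> {..t} \<times> {j + 1}"

definition sweep_end :: "nat \<Rightarrow> nat \<Rightarrow> (nat \<times> nat) config \<Rightarrow> bool" where
  "sweep_end m j c \<longleftrightarrow> (\<forall>l\<le>m. position c l = (min l (m - 1), j) \<and> moves c l = j) \<and>
     protected c = {..<m} \<times> {..j}"

text \<open>The top vertex of column \<open>j\<close> has two searchers for two unprotected
  neighbours. Every other vertex of the column has one searcher for at least two, so nothing else
  fires.\<close>

lemma sweep_first:
  assumes c: "sweep_start m j c" and "3 \<le> m" "j + 2 < n" "j < k"
  shows "\<exists>c'. stage k (strong_grid m n) (m + 1) c c' \<and> sweep m j 1 c'"
proof -
  let ?G = "strong_grid m n" and ?M = "{0, 1 :: nat}" and ?dest = "\<lambda>l. (l, j + 1)"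
  have pos: "position c l = (l - 1, j)" "moves c l = j" if "l \<le> m" for l
    using c that by (auto simp: sweep_start_def)
  have prot: "protected c = {..<m} \<times> {..j}" using c by (simp add: sweep_start_def)
  have nbrs: "unprotected_nbrs ?G c (0, j) = {(0, j + 1), (1, j + 1)}"
    using assms by (auto simp: unprotected_nbrs_grid prot)
  have mobile: "mobile_on k (m + 1) c (0, j) = {0, 1}"
    using assms by (auto simp: mobile_on_def pos)
  have fires0: "fires k ?G (m + 1) c (0, j)"
    unfolding fires_def nbrs mobile using assms by (simp add: strong_grid_verts)
  have only: "v = (0, j)" if f: "fires k ?G (m + 1) c v" for v
  proof -
    obtain l where "l < m + 1" and "position c l = v"
      by (rule fires_mobile[OF finite_strong_grid f])
    then have l: "l \<le> m" "position c l = v" by simp_all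
    show ?thesis
    proof (cases "l \<le> 1")
      case False
      have "mobile_on k (m + 1) c v \<subseteq> {l}" using l pos False by (auto simp: mobile_on_def)
      moreover have "(l - 1, j + 1) \<in> unprotected_nbrs ?G c v" "(l - 2, j + 1) \<in> unprotected_nbrs ?G c v"
        unfolding l(2)[symmetric] pos(1)[OF l(1)] unprotected_nbrs_grid prot using l assms False by auto
      ultimately show ?thesis
        using not_firesI[OF finite_strong_grid, of k "m + 1" c v l] f False by auto
    qed (use l pos in auto)
  qed
  have "stage k ?G (m + 1) c
     \<lparr> position = (\<lambda>i. if i \<in> ?M then ?dest i else position c i),
       moves = (\<lambda>i. if i \<in> ?M then Suc (moves c i) else moves c i),
       protected = protected c \<union> ?dest ` ?M \<rparr>" (is "stage _ _ _ _ ?c'")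
  proof (rule stage.intros)
    fix i assume "i \<in> ?M"
    then have "position c i = (0, j)" "i \<in> mobile_on k (m + 1) c (0, j)"
      "(i, j + 1) \<in> unprotected_nbrs ?G c (0, j)"
      using assms pos mobile nbrs by auto
    then show "i \<in> mobile_on k (m + 1) c (position c i) \<and> fires k ?G (m + 1) c (position c i) \<and>
        (i, j + 1) \<in> unprotected_nbrs ?G c (position c i)"
      using fires0 by simp
  next
    fix v u assume f: "fires k ?G (m + 1) c v" and u: "u \<in> unprotected_nbrs ?G c v"
    have v: "v = (0, j)" by (rule only[OF f])
    moreover have "u \<in> {(0, j + 1), (1, j + 1)}" using u unfolding v nbrs .
    moreover have "position c 0 = (0, j)" "position c 1 = (0, j)" using pos assms by simp_all
    ultimately show "\<exists>i\<in>?M. position c i = v \<and> (i, j + 1) = u" by auto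
  qed simp
  moreover have "sweep m j 1 ?c'"
    using assms pos by (auto simp: sweep_def prot le_Suc_eq)
  ultimately show ?thesis by blast
qed

text \<open>Each of these searchers is alone on its vertex and sees two unprotected vertices: one
  that has arrived sees two in column \<open>j + 2\<close>, one below row \<open>t\<close> of column
  \<open>j\<close> sees two in column \<open>j + 1\<close>. The last hypothesis excludes the bottom
  searcher once only row \<open>m - 1\<close> of column \<open>j + 1\<close> is left.\<close>

lemma sweep_not_fires:
  assumes c: "sweep m j t c" and "1 \<le> t" "t + 1 < m" "j + 2 < n" "l \<le> m" "l \<noteq> t + 1"
    and "l \<noteq> m \<or> t + 2 < m"
  shows "\<not> fires k (strong_grid m n) (m + 1) c (position c l)"
proof -
  let ?G = "strong_grid m n"
  have pos: "position c l = (if l \<le> t then (l, j + 1) else (l - 1, j))" if "l \<le> m" for l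
    using c that by (auto simp: sweep_def)
  have prot: "protected c = {..<m} \<times> {..j} \<union> {..t} \<times> {j + 1}" using c by (simp add: sweep_def)
  have mobile: "mobile_on k (m + 1) c (position c l) \<subseteq> {l}"
    using pos assms by (auto simp: mobile_on_def split: if_splits)
  have "\<exists>a b. a \<in> unprotected_nbrs ?G c (position c l) \<and> b \<in> unprotected_nbrs ?G c (position c l) \<and> a \<noteq> b"
  proof -
    consider "l \<le> t" | "l = t + 2" | "t + 2 < l" using assms by linarith
    then show ?thesis
    proof cases
      case 1
      then have "(l, j + 2) \<in> unprotected_nbrs ?G c (position c l)"
        "(l + 1, j + 2) \<in> unprotected_nbrs ?G c (position c l)"
        using assms by (auto simp: pos unprotected_nbrs_grid prot)
      then show ?thesis by (metis Pair_inject n_not_Suc_n Suc_eq_plus1)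
    next
      case 2
      then have "(t + 1, j + 1) \<in> unprotected_nbrs ?G c (position c l)"
        "(t + 2, j + 1) \<in> unprotected_nbrs ?G c (position c l)"
        using assms by (auto simp: pos unprotected_nbrs_grid prot)
      then show ?thesis by fastforce
    next
      case 3
      then have "(l - 1, j + 1) \<in> unprotected_nbrs ?G c (position c l)"
        "(l - 2, j + 1) \<in> unprotected_nbrs ?G c (position c l)"
        using assms by (auto simp: pos unprotected_nbrs_grid prot)
      moreover have "l - 1 \<noteq> l - 2" using 3 by simp
      ultimately show ?thesis by fast
    qed
  qed
  then show ?thesis using not_firesI[OF finite_strong_grid mobile] by blast
qed

text \<open>The frontier searcher \<open>t + 1\<close> stands in row \<open>t\<close> and lacks only
  \<open>(t + 1, j + 1)\<close>. If that is in the bottom row, searcher \<open>m\<close> below lacks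
  the same vertex and must fire too, which doubles the bottom end.\<close>

lemma sweep_stage:
  assumes c: "sweep m j t c" and "1 \<le> t" "t + 1 < m" "j + 2 < n" "j < k"
  shows "\<exists>c'. stage k (strong_grid m n) (m + 1) c c' \<and>
    (if t + 2 < m then sweep m j (t + 1) c' else sweep_end m (j + 1) c')"
proof -
  let ?G = "strong_grid m n"
  let ?M = "if t + 2 < m then {t + 1} else {t + 1, m}" and ?dest = "\<lambda>l::nat. (t + 1, j + 1)"
  have pos: "position c l = (if l \<le> t then (l, j + 1) else (l - 1, j))"
    "moves c l = (if l \<le> t then j + 1 else j)" if "l \<le> m" for l
    using c that by (auto simp: sweep_def)
  have prot: "protected c = {..<m} \<times> {..j} \<union> {..t} \<times> {j + 1}" using c by (simp add: sweep_def)
  have M: "i \<le> m" "t < i" "position c i = (i - 1, j)" "moves c i = j"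
    "i \<in> mobile_on k (m + 1) c (i - 1, j)" if "i \<in> ?M" for i
    using that assms pos by (auto simp: mobile_on_def split: if_splits)
  have nbrs: "unprotected_nbrs ?G c (i - 1, j) = {(t + 1, j + 1)}" if "i \<in> ?M" for i
    using that assms by (auto simp: unprotected_nbrs_grid prot split: if_splits)
  have fires: "fires k ?G (m + 1) c (i - 1, j)" if "i \<in> ?M" for i
  proof (rule firesI[where A = "{(t + 1, j + 1)}"])
    show "(i - 1, j) \<in> pverts ?G" using that assms by (auto simp: strong_grid_verts split: if_splits)
    have "finite (mobile_on k (m + 1) c (i - 1, j))" by (simp add: mobile_on_def)
    then have "0 < card (mobile_on k (m + 1) c (i - 1, j))"
      using M(5)[OF that] card_gt_0_iff by blast
    then show "card {(t + 1, j + 1)} \<le> card (mobile_on k (m + 1) c (i - 1, j))" by simp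
  qed (use nbrs[OF that] in simp_all)
  have "stage k ?G (m + 1) c
     \<lparr> position = (\<lambda>i. if i \<in> ?M then ?dest i else position c i),
       moves = (\<lambda>i. if i \<in> ?M then Suc (moves c i) else moves c i),
       protected = protected c \<union> ?dest ` ?M \<rparr>" (is "stage _ _ _ _ ?c'")
  proof (rule stage.intros)
    fix i assume "i \<in> ?M"
    then show "i \<in> mobile_on k (m + 1) c (position c i) \<and> fires k ?G (m + 1) c (position c i) \<and>
        (t + 1, j + 1) \<in> unprotected_nbrs ?G c (position c i)"
      using M fires nbrs by (metis singletonI)
  next
    fix v u assume f: "fires k ?G (m + 1) c v" and u: "u \<in> unprotected_nbrs ?G c v"
    obtain l where "l < m + 1" and "position c l = v"
      by (rule fires_mobile[OF finite_strong_grid f])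
    then have l: "l \<le> m" "position c l = v" by simp_all
    have "l = t + 1 \<or> (l = m \<and> \<not> t + 2 < m)"
      using sweep_not_fires[OF c _ _ _ l(1), of n k] f l(2) assms by metis
    then have "l \<in> ?M" by auto
    with l u M(3) nbrs show "\<exists>i\<in>?M. position c i = v \<and> (t + 1, j + 1) = u" by (metis singletonD)
  qed simp
  moreover have "if t + 2 < m then sweep m j (t + 1) ?c' else sweep_end m (j + 1) ?c'"
  proof (cases "t + 2 < m")
    case True
    then show ?thesis using assms pos by (auto simp: sweep_def prot le_Suc_eq)
  next
    case False
    then have m: "m = t + 2" using assms by simp
    have "position ?c' l = (min l (m - 1), j + 1) \<and> moves ?c' l = j + 1" if "l \<le> m" for l
    proof -
      consider "l \<le> t" | "l = t + 1" | "l = m" using \<open>l \<le> m\<close> m by linarith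
      then show ?thesis by cases (use pos[OF that] m in auto)
    qed
    moreover have "protected ?c' = {..<m} \<times> {..j + 1}"
      by (auto simp: prot m less_Suc_eq le_Suc_eq)
    ultimately have "sweep_end m (j + 1) ?c'" unfolding sweep_end_def by blast
    then show ?thesis unfolding if_not_P[OF False] .
  qed
  ultimately show ?thesis by blast
qed

lemma sweep_column:
  assumes "sweep_start m j c" "3 \<le> m" "j + 2 < n" "j < k"
  shows "\<exists>c'. (stage k (strong_grid m n) (m + 1))\<^sup>*\<^sup>* c c' \<and> sweep_end m (j + 1) c'"
proof -
  have upto: "\<exists>c'. (stage k (strong_grid m n) (m + 1))\<^sup>*\<^sup>* c c' \<and> sweep m j (t + 1) c'" if "t + 2 < m" for t
    using that
  proof (induction t)
    case 0
    then show ?case using sweep_first[OF assms] by auto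
  next
    case (Suc t)
    then obtain c' where c': "(stage k (strong_grid m n) (m + 1))\<^sup>*\<^sup>* c c'" "sweep m j (t + 1) c'" by auto
    from sweep_stage[OF c'(2), of n k] c'(1) assms Suc.prems show ?case
      by (auto intro: rtranclp.rtrancl_into_rtrancl)
  qed
  obtain t where t: "m = t + 3" using assms(2) by (metis le_add_diff_inverse2)
  obtain c' where c': "(stage k (strong_grid m n) (m + 1))\<^sup>*\<^sup>* c c'" "sweep m j (t + 1) c'"
    using upto[of t] t by auto
  from sweep_stage[OF c'(2), of n k] c'(1) assms t show ?thesis
    by (auto intro: rtranclp.rtrancl_into_rtrancl)
qed

text \<open>Both maps are the identity out of range because the locale demands involutions on all
  pairs and all naturals.\<close>

lemma game_symmetry_strong_grid:
  "game_symmetry (strong_grid m n) (m + 1)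
     (\<lambda>(i, j). (if i < m then m - 1 - i else i, j)) (\<lambda>l. if l \<le> m then m - l else l)"
proof
  fix v u :: "nat \<times> nat"
  assume "(v, u) \<in> parcs (strong_grid m n)"
  then show "((case v of (i, j) \<Rightarrow> (if i < m then m - 1 - i else i, j)),
    (case u of (i, j) \<Rightarrow> (if i < m then m - 1 - i else i, j))) \<in> parcs (strong_grid m n)"
    by (cases v; cases u) (auto simp: strong_grid_arcs)
qed (auto simp: strong_grid_verts split: prod.splits)

text \<open>The arrival row of searcher \<open>m - l\<close> reflects to
  \<open>m - 1 - min (m - l) (m - 1)\<close>, which is the truncated \<open>l - 1\<close>.\<close>

lemma sweep_end_turn:
  assumes "sweep_end m j c" "3 \<le> m"
  shows "sweep_start m j
    (transport (\<lambda>(i, j). (if i < m then m - 1 - i else i, j)) (\<lambda>l. if l \<le> m then m - l else l) c)"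
proof -
  have "(\<lambda>(i, j). (if i < m then m - 1 - i else i, j)) ` ({..<m} \<times> {..j}) = {..<m} \<times> {..j}"
    (is "?f ` ?A = ?A")
  proof
    show "?A \<subseteq> ?f ` ?A"
    proof
      fix x assume "x \<in> ?A"
      then show "x \<in> ?f ` ?A" by (intro image_eqI[of _ _ "?f x"]) (auto split: prod.splits)
    qed
  qed auto
  then show ?thesis using assms by (auto simp: sweep_end_def sweep_start_def transport_def)
qed

text \<open>In the last column a searcher that has just arrived may fire as well, if it can still move,
  so the play is controlled by an invariant instead of being followed explicitly.\<close>

lemma win_last_column:
  assumes c: "sweep_start m j c" and m: "3 \<le> m" and n: "n = j + 2" and k: "j < k"
  shows "win k (strong_grid m n) (m + 1) c"
proof -
  let ?G = "strong_grid m n"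
  let ?mob = "\<lambda>c i. mobile_on k (m + 1) c (i, j)"
  \<comment> \<open>Searchers in the last column are left unconstrained: their moves only protect
    further vertices, which breaks no clause.\<close>
  define I where "I c \<longleftrightarrow> {..<m} \<times> {..j} \<subseteq> protected c \<and>
    (\<forall>i<m. unprotected_nbrs ?G c (i, j) = {} \<or> ?mob c i \<noteq> {}) \<and>
    ({(0, j + 1), (1, j + 1)} \<subseteq> protected c \<or> 2 \<le> card (?mob c 0))" for c
  have fin: "finite (?mob c i)" for c i by (simp add: mobile_on_def)
  show ?thesis
  proof (rule win_by_invariant[where I = I])
    show "finite (pverts ?G)" by (rule finite_strong_grid)
  next
    fix c c' assume I: "I c" and st: "stage k ?G (m + 1) c c'"
    have sub: "protected c \<subseteq> protected c'" using stage_protected_psubset[OF st] by blast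
    have "unprotected_nbrs ?G c' (i, j) = {} \<or> ?mob c' i \<noteq> {}" if "i < m" for i
    \<comment> \<open>A firing vertex ends up without unprotected neighbours; any other keeps its
      mobile searchers.\<close>
    proof (cases "fires k ?G (m + 1) c (i, j)")
      case True
      then have "unprotected_nbrs ?G c' (i, j) = {}"
        using stage_fires[OF st True] by (auto simp: unprotected_nbrs_def)
      then show ?thesis ..
    next
      case False
      have "unprotected_nbrs ?G c' (i, j) \<subseteq> unprotected_nbrs ?G c (i, j)"
        using sub by (auto simp: unprotected_nbrs_def)
      then show ?thesis using I that stage_not_fires[OF st False] unfolding I_def by blast
    qed
    moreover have "{(0, j + 1), (1, j + 1)} \<subseteq> protected c' \<or> 2 \<le> card (?mob c' 0)"
    proof (cases "fires k ?G (m + 1) c (0, j)")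
      case True
      have "(0, j + 1) \<in> protected c'" "(1, j + 1) \<in> protected c'"
        by (rule stage_fires[OF st True]; use m n in \<open>simp add: strong_grid_arcs strong_grid_verts\<close>)+
      then show ?thesis by simp
    next
      case False
      show ?thesis
        using I sub card_mono[OF fin stage_not_fires[OF st False]] unfolding I_def by (meson order_trans)
    qed
    ultimately show "I c'" using I sub by (auto simp: I_def)
  next
    fix c assume I: "I c" and np: "\<not> pverts ?G \<subseteq> protected c"
    have old: "(i, j') \<in> protected c" if "i < m" "j' \<le> j" for i j' using I that by (auto simp: I_def)
    have "\<exists>i. i < m \<and> (i, j + 1) \<notin> protected c"
    proof -
      obtain i j' where "i < m" "j' < n" "(i, j') \<notin> protected c" using np by (auto simp: strong_grid_verts)
      moreover from this have "j' = j + 1" using old[of i j'] n by (cases "j' \<le> j") auto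
      ultimately show ?thesis by blast
    qed
    then obtain i where i: "i < m" "(i, j + 1) \<notin> protected c"
      and least: "\<And>i'. i' < i \<Longrightarrow> i' < m \<Longrightarrow> (i', j + 1) \<in> protected c"
      using exists_least_iff[of "\<lambda>i. i < m \<and> (i, j + 1) \<notin> protected c"] by blast
    \<comment> \<open>The topmost gap can be closed from the row above. For \<open>i \<le> 1\<close>
      truncation gives row 0, whose two searchers cover rows 0 and 1; further down minimality makes
      \<open>(i, j + 1)\<close> the only gap in reach.\<close>
    have "fires k ?G (m + 1) c (i - 1, j)"
    proof (cases "i \<le> 1")
      case True
      show ?thesis
      proof (rule firesI[where A = "{(0, j + 1), (1, j + 1)}"])
        show "unprotected_nbrs ?G c (i - 1, j) \<noteq> {}"
          using i True n m unprotected_nbrs_grid[of i "j + 1" m n c "i - 1" j] by auto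
        show "unprotected_nbrs ?G c (i - 1, j) \<subseteq> {(0, j + 1), (1, j + 1)}"
        proof clarify
          fix a b assume "(a, b) \<in> unprotected_nbrs ?G c (i - 1, j)"
          then have "a < m" "a \<le> 1" "b < n" "(a, b) \<notin> protected c"
            using True by (auto simp: unprotected_nbrs_grid)
          then show "a = 1 \<and> b = j + 1"
            if "\<not> (a = 0 \<and> b = j + 1)"
            using that old[of a b] n by (cases "b \<le> j") auto
        qed
        have "i = 0 \<or> i = 1" using True by linarith
        then have "2 \<le> card (?mob c 0)" using I i by (auto simp: I_def)
        then show "card {(0, j + 1), (1, j + 1)} \<le> card (?mob c (i - 1))" using True by (simp add: card_insert_if)
      qed (use m n i in \<open>auto simp: strong_grid_verts\<close>)
    next
      case False
      have ne: "unprotected_nbrs ?G c (i - 1, j) \<noteq> {}"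
        using i False n m unprotected_nbrs_grid[of i "j + 1" m n c "i - 1" j] by auto
      show ?thesis
      proof (rule firesI[where A = "{(i, j + 1)}"])
        show "unprotected_nbrs ?G c (i - 1, j) \<subseteq> {(i, j + 1)}"
        proof clarify
          fix a b assume "(a, b) \<in> unprotected_nbrs ?G c (i - 1, j)"
          then have "a < m" "a \<le> i" "b < n" "(a, b) \<notin> protected c"
            using False by (auto simp: unprotected_nbrs_grid)
          moreover from this have "b = j + 1" using old[of a b] n by (cases "b \<le> j") auto
          ultimately show "a = i \<and> b = j + 1" using least[of a] by (cases "a < i") auto
        qed
        have "i - 1 < m" using i by simp
        then have "?mob c (i - 1) \<noteq> {}" using I ne unfolding I_def by blast
        then have "0 < card (?mob c (i - 1))" using fin[of c "i - 1"] by (simp add: card_gt_0_iff)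
        then show "card {(i, j + 1)} \<le> card (?mob c (i - 1))" by simp
      qed (use ne n i in \<open>auto simp: strong_grid_verts\<close>)
    qed
    then show "\<exists>v. fires k ?G (m + 1) c v" ..
  next
    have mob: "l \<in> ?mob c (l - 1)" if "l \<le> m" for l
      using c k that by (auto simp: sweep_start_def mobile_on_def)
    have "?mob c i \<noteq> {}" if "i < m" for i using mob[of "i + 1"] that by auto
    moreover have "card {0, 1::nat} \<le> card (?mob c 0)"
      using mob[of 0] mob[of 1] m by (intro card_mono fin) auto
    moreover have "{..<m} \<times> {..j} \<subseteq> protected c" using c by (simp add: sweep_start_def)
    ultimately show "I c" by (simp add: I_def)
    show "protected c \<subseteq> pverts ?G" using c n by (auto simp: sweep_start_def strong_grid_verts)
  qed
qed

text \<open>A searcher in column \<open>j\<close> has made \<open>j\<close> moves, and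
  \<open>j + 2 \<le> n \<le> k + 1\<close> leaves it at least one more. Each sweep is followed by a
  reflection, until only the last column remains.\<close>

lemma win_sweep_start:
  assumes "sweep_start m j c" "3 \<le> m" "j + 2 \<le> n" "n \<le> k + 1"
  shows "win k (strong_grid m n) (m + 1) c"
  using assms
proof (induction "n - j" arbitrary: j c rule: less_induct)
  case less
  show ?case
  proof (cases "j + 2 = n")
    case True
    then show ?thesis using win_last_column[of m j c n k] less.prems by simp
  next
    case False
    interpret game_symmetry "strong_grid m n" "m + 1" "\<lambda>(i, j). (if i < m then m - 1 - i else i, j)"
      "\<lambda>l. if l \<le> m then m - l else l"
      by (rule game_symmetry_strong_grid)
    obtain c' where c': "(stage k (strong_grid m n) (m + 1))\<^sup>*\<^sup>* c c'" "sweep_end m (j + 1) c'"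
      using sweep_column[of m j c n k] less.prems False by auto
    have "win k (strong_grid m n) (m + 1) c'"
      by (rule win_transport, rule less.hyps[OF _ sweep_end_turn[OF c'(2)]]) (use less.prems False in auto)
    with c'(1) show ?thesis by (rule win_stages)
  qed
qed


section \<open>The deduction number\<close>

theorem theorem5p2:
  fixes k m n :: nat
  assumes "1 \<le> k" and "3 \<le> m" and "m \<le> n" and "n \<le> k + 1"
  shows "deduction_number k (path_graph m \<boxtimes> path_graph n) = m + 1"
  unfolding deduction_number_def
proof (rule Least_equality)
  let ?L = "\<lambda>l::nat. (l - 1, 0::nat)"
  have img: "?L ` {..<m + 1} = {..<m} \<times> {..0}"
  proof
    show "{..<m} \<times> {..0} \<subseteq> ?L ` {..<m + 1}"
      by (auto intro!: image_eqI[of _ _ "Suc _"])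
  qed (use assms in auto)
  then have "sweep_start m 0 (initial_config (m + 1) ?L)"
    by (simp add: sweep_start_def initial_config_def)
  then have "successful k (strong_grid m n) (m + 1) ?L"
    using win_sweep_start[of m 0 _ n k] assms by (simp add: win_def successful_def)
  moreover have "layout (strong_grid m n) (m + 1) ?L"
    using assms unfolding layout_def img strong_grid_verts by auto
  ultimately show "\<exists>L. layout (strong_grid m n) (m + 1) L \<and> successful k (strong_grid m n) (m + 1) L"
    by blast
next
  fix s assume "\<exists>L. layout (strong_grid m n) s L \<and> successful k (strong_grid m n) s L"
  then obtain L where L: "layout (strong_grid m n) s L" "successful k (strong_grid m n) s L" by blast
  show "m + 1 \<le> s"
  proof (rule ccontr)
    assume "\<not> m + 1 \<le> s"
    then have s: "s \<le> m" by simp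
    \<comment> \<open>Weakening the boundary bound from \<open>s\<close> to \<open>m\<close> turns a
      chain for \<open>s\<close> searchers into one for \<open>m\<close>.\<close>
    have "(grow (strong_grid m n) m)\<^sup>*\<^sup>* (L ` {..<s}) ({..<m} \<times> {..<n})"
      using successful_grow[OF L] unfolding strong_grid_verts
      by (rule rtranclp_mono[THEN predicate2D, rotated]) (use s in \<open>auto simp: grow_def\<close>)
    moreover have "card (L ` {..<s}) \<le> m" using card_image_le[of "{..<s}" L] s by simp
    moreover have "L ` {..<s} \<subseteq> {..<m} \<times> {..<n}"
      using L(1) by (simp add: layout_def strong_grid_verts)
    ultimately show False using no_grow_strong_grid assms(2,3) by blast
  qed
qed

end
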